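(* The function $t_M(x)=t_M([0,x])$ is continuous on $(0,\infty)$.
   Context: Let $\mathcal{M}_n[x]$ denote the set of monic polynomials of degree $n$ with integer coefficients, and for a polynomial $p$ and closed interval $I\subset\mathbb{R}$ let $\|p\|_I=\sup_{x\in I}|p(x)|$. The monic integer transfinite diameter of a closed interval $I$ is $t_M(I)=\lim_{n\to\infty}\inf_{p_n\in\mathcal{M}_n[x]}\|p_n\|_I^{1/n}$. For $x>0$ set $t_M(x)=t_M([0,x])$. *)

theory Defs
  imports Complex_Main "HOL-Computational_Algebra.Polynomial"
begin

definition monic_int_polys :: "nat \<Rightarrow> int poly set" where
  "monic_int_polys n = {p. degree p = n \<and> lead_coeff p = 1}"

definition sup_norm_on :: "real set \<Rightarrow> int poly \<Rightarrow> real" where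
  "sup_norm_on I p = (SUP x\<in>I. \<bar>poly (map_poly real_of_int p) x\<bar>)"

text \<open>
  The limit exists for every nondegenerate compact interval, since the infimum of the norms is
  submultiplicative in \<open>n\<close> and positive. The term for \<open>n = 0\<close> does not affect it.
\<close>
definition monic_int_transfinite_diameter :: "real set \<Rightarrow> real" where
  "monic_int_transfinite_diameter I =
     lim (\<lambda>n. INF p\<in>monic_int_polys n. sup_norm_on I p powr (1 / real n))"

definition t_M :: "real \<Rightarrow> real" where
  "t_M x = monic_int_transfinite_diameter {0..x}"

end

theory Submission
  imports Defs "HOL-Complex_Analysis.Conformal_Mappings"
begin

text \<open>
  If a polynomial \<open>p\<close> of degree \<open>n\<close> is bounded by \<open>M\<close> on \<open>[-1,1]\<close>, then \<open>w\<^sup>n p((w + 1/w)/2)\<close> extends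
  to an entire function bounded by \<open>M\<close> on the unit circle, hence on the unit disc. This is the
  Bernstein--Walsh inequality \<open>\<bar>p(s)\<bar> \<le> M \<rho>(s)\<^sup>n\<close>, where \<open>\<rho> \<ge> 1\<close> solves \<open>(\<rho> + 1/\<rho>)/2 = \<bar>s\<bar>\<close> for
  \<open>\<bar>s\<bar> \<ge> 1\<close> and \<open>\<rho>(s) = 1\<close> on \<open>[-1,1]\<close>. Rescaling \<open>[0,y]\<close> to \<open>[-1,1]\<close> and taking infima over monic
  integer polynomials and \<open>n\<close>-th roots, \<open>t\<^sub>M(x) \<le> t\<^sub>M(y) \<rho>(2x/y - 1)\<close> for all positive \<open>x\<close> and
  \<open>y\<close>; since \<open>\<rho>\<close> is continuous with \<open>\<rho>(1) = 1\<close>, exchanging \<open>x\<close> and \<open>y\<close> squeezes \<open>t\<^sub>M(x)\<close> to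
  \<open>t\<^sub>M(y)\<close>. The defining limit exists by Fekete's lemma, as products of monic polynomials are monic.
\<close>

subsection \<open>The Bernstein--Walsh inequality\<close>

definition Joukowski :: "complex \<Rightarrow> complex" where
  "Joukowski w = (w + inverse w) / 2"

lemma Joukowski_inverse [simp]: "Joukowski (inverse w) = Joukowski w"
  by (simp add: Joukowski_def add.commute)

lemma Joukowski_of_real: "Joukowski (of_real r) = of_real ((r + inverse r) / 2)"
  by (simp add: Joukowski_def)

lemma Joukowski_unit_circle:
  assumes "norm w = 1"
  shows "Joukowski w = of_real (Re w)"
proof -
  have "inverse w = cnj w"
    using assms divide_conv_cnj[of w 1] by (simp add: inverse_eq_divide)
  then show ?thesis
    by (simp add: Joukowski_def complex_add_cnj)
qed

lemma poly_Joukowski_extends_holomorphic: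
  fixes p :: "complex poly"
  obtains G where "G holomorphic_on UNIV"
    and "\<And>w. w \<noteq> 0 \<Longrightarrow> G w = w ^ degree p * poly p (Joukowski w)"
proof
  let ?n = "degree p"
  let ?G = "\<lambda>w. \<Sum>k\<le>?n. coeff p k * ((w\<^sup>2 + 1) / 2) ^ k * w ^ (?n - k)"
  show "?G holomorphic_on UNIV"
    by (intro holomorphic_intros) auto
  fix w :: complex
  assume "w \<noteq> 0"
  then have numerator: "(w\<^sup>2 + 1) / 2 = w * Joukowski w"
    by (simp add: Joukowski_def power2_eq_square field_simps)
  have "((w\<^sup>2 + 1) / 2) ^ k * w ^ (?n - k) = w ^ ?n * Joukowski w ^ k" if "k \<le> ?n" for k
    using that unfolding numerator
    by (simp add: power_mult_distrib mult_ac flip: power_add)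
  then show "?G w = w ^ ?n * poly p (Joukowski w)"
    by (auto simp: poly_altdef sum_distrib_left mult_ac intro!: sum.cong)
qed

theorem Bernstein_Walsh:
  fixes p :: "complex poly"
  assumes bound: "\<And>s. s \<in> {-1..1} \<Longrightarrow> norm (poly p (of_real s)) \<le> M"
    and w: "1 \<le> norm w"
  shows "norm (poly p (Joukowski w)) \<le> M * norm w ^ degree p"
proof -
  obtain G where holomorphic: "G holomorphic_on UNIV"
    and G: "\<And>u. u \<noteq> 0 \<Longrightarrow> G u = u ^ degree p * poly p (Joukowski u)"
    using poly_Joukowski_extends_holomorphic[of p] by blast
  have "norm (G (inverse w)) \<le> M"
  proof (rule maximum_modulus_frontier[of G "cball 0 1"])
    show "G holomorphic_on interior (cball 0 1)" "continuous_on (closure (cball 0 1)) G"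
      using holomorphic_on_subset[OF holomorphic]
      by (auto intro: holomorphic_on_imp_continuous_on)
    show "norm (G u) \<le> M" if "u \<in> frontier (cball 0 1)" for u
    proof -
      have u: "norm u = 1" "u \<noteq> 0"
        using that by auto
      then have "Re u \<in> {-1..1}"
        using abs_Re_le_cmod[of u] by auto
      then show ?thesis
        using u bound by (simp add: G Joukowski_unit_circle norm_mult norm_power)
    qed
    show "inverse w \<in> cball 0 1"
      using w by (simp add: norm_inverse inverse_le_1_iff)
  qed simp
  moreover have "w \<noteq> 0"
    using w by auto
  ultimately have "norm (poly p (Joukowski w)) / norm w ^ degree p \<le> M"
    by (simp add: G norm_mult norm_power norm_inverse power_inverse divide_inverse mult.commute)
  then show ?thesis
    using \<open>w \<noteq> 0\<close> by (simp add: pos_divide_le_eq)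
qed

text \<open>
  The sum of the semi-axes of the ellipse with foci \<open>-1\<close> and \<open>1\<close> through the real point \<open>s\<close>,
  which is the segment \<open>[-1,1]\<close> itself if \<open>\<bar>s\<bar> \<le> 1\<close>.
\<close>
definition Bernstein_radius :: "real \<Rightarrow> real" where
  "Bernstein_radius s = max 1 \<bar>s\<bar> + sqrt ((max 1 \<bar>s\<bar>)\<^sup>2 - 1)"

lemma Bernstein_radius_eq_1: "\<bar>s\<bar> \<le> 1 \<Longrightarrow> Bernstein_radius s = 1"
  by (simp add: Bernstein_radius_def)

lemma Bernstein_radius_ge_1: "1 \<le> Bernstein_radius s"
proof -
  have "1 \<le> max 1 \<bar>s\<bar>" "0 \<le> sqrt ((max 1 \<bar>s\<bar>)\<^sup>2 - 1)"
    by simp_all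
  then show ?thesis
    unfolding Bernstein_radius_def by linarith
qed

lemma Bernstein_radius_pos: "0 < Bernstein_radius s"
  using Bernstein_radius_ge_1[of s] by linarith

lemma Bernstein_radius_mono: "\<bar>s\<bar> \<le> max 1 \<bar>t\<bar> \<Longrightarrow> Bernstein_radius s \<le> Bernstein_radius t"
  unfolding Bernstein_radius_def
  by (intro add_mono real_sqrt_le_mono diff_right_mono power_mono) auto

lemma continuous_Bernstein_radius [continuous_intros]:
  "continuous F f \<Longrightarrow> continuous F (\<lambda>x. Bernstein_radius (f x))"
  unfolding Bernstein_radius_def by (intro continuous_intros)

lemma Joukowski_preimage_real:
  obtains w where "norm w = Bernstein_radius s" and "Joukowski w = of_real s"
proof (cases "\<bar>s\<bar> \<le> 1")
  case True
  then have "Joukowski (cis (arccos s)) = of_real s"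
    by (simp add: Joukowski_unit_circle cos_arccos_abs)
  then show ?thesis
    using True by (intro that[of "cis (arccos s)"]) (simp_all add: Bernstein_radius_eq_1)
next
  case False
  let ?r = "Bernstein_radius s" and ?d = "sqrt (s\<^sup>2 - 1)"
  have r: "?r = \<bar>s\<bar> + ?d"
    using False by (simp add: Bernstein_radius_def max_def)
  have "?d\<^sup>2 = s\<^sup>2 - 1"
    using False abs_le_square_iff[of 1 s] by simp
  then have "?r * (\<bar>s\<bar> - ?d) = 1"
    by (simp add: r algebra_simps power2_eq_square)
  then have "inverse ?r = \<bar>s\<bar> - ?d"
    by (rule inverse_unique)
  moreover have "inverse (sgn s) = sgn s"
    using False by (auto simp: sgn_if)
  ultimately have "inverse (sgn s * ?r) = sgn s * (\<bar>s\<bar> - ?d)"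
    by simp
  moreover have "sgn s * ?r + sgn s * (\<bar>s\<bar> - ?d) = 2 * s"
    by (simp add: r sgn_mult_abs abs_mult_sgn algebra_simps)
  ultimately have "Joukowski (of_real (sgn s * ?r)) = of_real s"
    by (simp only: Joukowski_of_real) simp
  moreover have "norm (of_real (sgn s * ?r) :: complex) = ?r"
    using False Bernstein_radius_ge_1[of s] by (simp add: norm_mult abs_sgn_eq)
  ultimately show ?thesis
    by (intro that)
qed

lemma poly_map_poly_of_real:
  fixes p :: "real poly"
  shows "poly (map_poly of_real p) (of_real x) =
    (of_real (poly p x) :: 'a :: {comm_ring_1, real_algebra_1})"
  by (simp add: poly_altdef degree_map_poly coeff_map_poly)

lemma poly_growth_symmetric_interval:
  fixes p :: "real poly"
  assumes "\<And>t. t \<in> {-1..1} \<Longrightarrow> \<bar>poly p t\<bar> \<le> M"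
  shows "\<bar>poly p s\<bar> \<le> M * Bernstein_radius s ^ degree p"
proof -
  obtain w where w: "norm w = Bernstein_radius s" "Joukowski w = of_real s"
    by (rule Joukowski_preimage_real)
  let ?p = "map_poly complex_of_real p"
  have "norm (poly ?p (Joukowski w)) \<le> M * norm w ^ degree ?p"
    using assms w Bernstein_radius_ge_1
    by (intro Bernstein_Walsh) (auto simp: poly_map_poly_of_real)
  then show ?thesis
    by (simp add: w poly_map_poly_of_real degree_map_poly)
qed

lemma poly_growth_interval:
  fixes p :: "real poly"
  assumes "a < b" and bound: "\<And>t. t \<in> {a..b} \<Longrightarrow> \<bar>poly p t\<bar> \<le> M"
  shows "\<bar>poly p x\<bar> \<le> M * Bernstein_radius ((2 * x - a - b) / (b - a)) ^ degree p"
proof -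
  let ?q = "p \<circ>\<^sub>p [:(a + b) / 2, (b - a) / 2:]"
  have "\<bar>poly ?q t\<bar> \<le> M" if "t \<in> {-1..1}" for t
  proof -
    have "\<bar>t * (b - a)\<bar> \<le> b - a"
      using that \<open>a < b\<close> by (simp add: abs_mult mult_left_le_one_le abs_le_iff)
    then have "(a + b) / 2 + t * (b - a) / 2 \<in> {a..b}"
      by (auto simp: field_simps abs_le_iff)
    then show ?thesis
      using bound by (simp add: poly_pcompose)
  qed
  then have "\<bar>poly ?q ((2 * x - a - b) / (b - a))\<bar>
      \<le> M * Bernstein_radius ((2 * x - a - b) / (b - a)) ^ degree ?q"
    by (rule poly_growth_symmetric_interval)
  moreover have "(a + b) / 2 + (2 * x - a - b) / (b - a) * ((b - a) / 2) = x"
    using \<open>a < b\<close> by (simp add: field_simps)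
  ultimately show ?thesis
    using \<open>a < b\<close> by (simp add: poly_pcompose degree_pcompose)
qed

subsection \<open>Fekete's lemma for submultiplicative sequences\<close>

locale submultiplicative_sequence =
  fixes u :: "nat \<Rightarrow> real"
  assumes nonneg: "0 \<le> u n"
    and submultiplicative: "u (m + n) \<le> u m * u n"
begin

lemma mult_add_le: "u (m * q + r) \<le> u m ^ q * u r"
proof (induction q)
  case (Suc q)
  have "u (m * Suc q + r) \<le> u m * u (m * q + r)"
    using submultiplicative[of m "m * q + r"] by (simp add: algebra_simps)
  also have "\<dots> \<le> u m * (u m ^ q * u r)"
    by (intro mult_left_mono Suc.IH nonneg)
  finally show ?case
    by (simp add: mult_ac)
qed simp

lemma geometric_bound:
  assumes "0 < m" "0 < d" "u m \<le> d ^ m"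
  obtains K where "0 < K" and "\<And>n. u n \<le> K * d ^ n"
proof
  let ?K = "1 + (\<Sum>r<m. u r / d ^ r)"
  show "0 < ?K"
    using nonneg \<open>0 < d\<close> by (intro add_pos_nonneg sum_nonneg) auto
  fix n
  let ?q = "n div m" and ?r = "n mod m"
  have "u ?r / d ^ ?r \<le> (\<Sum>r<m. u r / d ^ r)"
    using nonneg \<open>0 < m\<close> \<open>0 < d\<close> by (intro member_le_sum) auto
  then have "u ?r / d ^ ?r \<le> ?K"
    by simp
  then have remainder: "u ?r \<le> ?K * d ^ ?r"
    using \<open>0 < d\<close> by (simp add: pos_divide_le_eq)
  have d_power: "d ^ n = (d ^ m) ^ ?q * d ^ ?r"
    by (metis mult_div_mod_eq power_add power_mult)
  have "u n \<le> u m ^ ?q * u ?r"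
    using mult_add_le[of m ?q ?r] by simp
  also have "\<dots> \<le> (d ^ m) ^ ?q * (?K * d ^ ?r)"
    using assms remainder nonneg by (intro mult_mono power_mono) auto
  finally show "u n \<le> ?K * d ^ n"
    by (simp add: d_power mult_ac)
qed

lemma root_eventually_less:
  assumes "0 < m" "root m (u m) < c"
  shows "\<forall>\<^sub>F n in sequentially. root n (u n) < c"
proof -
  obtain d where d: "root m (u m) < d" "d < c"
    using assms dense by blast
  have root_nonneg: "0 \<le> root m (u m)"
    using nonneg by (simp add: real_root_ge_zero)
  have "u m = root m (u m) ^ m"
    using nonneg \<open>0 < m\<close> by simp
  also have "\<dots> \<le> d ^ m"
    using d root_nonneg by (intro power_mono) auto
  finally obtain K where "0 < K" and K: "\<And>n. u n \<le> K * d ^ n"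
    using geometric_bound[of m d] assms d root_nonneg by auto
  have bound: "root n (u n) \<le> root n K * d" if "0 < n" for n
  proof -
    have "root n (u n) \<le> root n (K * d ^ n)"
      using K that by simp
    then show ?thesis
      using that d root_nonneg by (simp add: real_root_mult real_root_power_cancel)
  qed
  have "(\<lambda>n. root n K * d) \<longlonglongrightarrow> 1 * d"
    using \<open>0 < K\<close> by (intro tendsto_intros LIMSEQ_root_const)
  then have "\<forall>\<^sub>F n in sequentially. root n K * d < c"
    using d by (intro order_tendstoD(2)) auto
  then show ?thesis
    using eventually_gt_at_top[of 0] by eventually_elim (rule le_less_trans[OF bound])
qed

theorem root_tendsto_INF:
  "(\<lambda>n. root n (u n)) \<longlonglongrightarrow> (INF n\<in>{0<..}. root n (u n))"
  (is "_ \<longlonglongrightarrow> ?L")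
proof (rule order_tendstoI)
  have bdd: "bdd_below ((\<lambda>n. root n (u n)) ` {0<..})"
    using nonneg by (intro bdd_belowI2[of _ 0]) (simp add: real_root_ge_zero)
  show "\<forall>\<^sub>F n in sequentially. c < root n (u n)" if "c < ?L" for c
    using eventually_gt_at_top[of 0]
    by eventually_elim (use that cINF_lower[OF bdd] in \<open>auto intro: less_le_trans\<close>)
  show "\<forall>\<^sub>F n in sequentially. root n (u n) < c" if less: "?L < c" for c
  proof -
    obtain m where "0 < m" "root m (u m) < c"
      using less by (auto simp: cINF_less_iff[OF _ bdd])
    then show ?thesis
      by (rule root_eventually_less)
  qed
qed

end

subsection \<open>Supremum norms of integer polynomials\<close>

lemma abs_poly_le_sup_norm_on:
  assumes "compact I" "t \<in> I"
  shows "\<bar>poly (map_poly real_of_int p) t\<bar> \<le> sup_norm_on I p"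
proof -
  have "compact ((\<lambda>t. \<bar>poly (map_poly real_of_int p) t\<bar>) ` I)"
    using assms by (intro compact_continuous_image continuous_intros)
  then show ?thesis
    unfolding sup_norm_on_def
    using assms by (intro cSUP_upper bounded_imp_bdd_above compact_imp_bounded)
qed

lemma sup_norm_on_leI:
  "I \<noteq> {} \<Longrightarrow> (\<And>t. t \<in> I \<Longrightarrow> \<bar>poly (map_poly real_of_int p) t\<bar> \<le> B) \<Longrightarrow> sup_norm_on I p \<le> B"
  unfolding sup_norm_on_def by (rule cSUP_least)

lemma sup_norm_on_nonneg: "compact I \<Longrightarrow> I \<noteq> {} \<Longrightarrow> 0 \<le> sup_norm_on I p"
  by (metis abs_ge_zero abs_poly_le_sup_norm_on ex_in_conv order_trans)

lemma map_poly_of_int_mult: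
  "map_poly of_int (p * q) = map_poly of_int p * (map_poly of_int q :: 'a :: comm_ring_1 poly)"
  by (simp add: poly_eq_iff coeff_map_poly coeff_mult)

lemma sup_norm_on_mult_le:
  assumes "compact I" "I \<noteq> {}"
  shows "sup_norm_on I (p * q) \<le> sup_norm_on I p * sup_norm_on I q"
  using assms
  by (intro sup_norm_on_leI)
    (auto simp: map_poly_of_int_mult abs_mult intro!: mult_mono abs_poly_le_sup_norm_on
      sup_norm_on_nonneg)

lemma sup_norm_on_growth:
  assumes "a < b" "J \<noteq> {}"
    and radius: "\<And>t. t \<in> J \<Longrightarrow> Bernstein_radius ((2 * t - a - b) / (b - a)) \<le> C"
  shows "sup_norm_on J p \<le> sup_norm_on {a..b} p * C ^ degree p"
proof (rule sup_norm_on_leI[OF \<open>J \<noteq> {}\<close>])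
  fix t assume "t \<in> J"
  let ?p = "map_poly real_of_int p" and ?r = "Bernstein_radius ((2 * t - a - b) / (b - a))"
  have "\<bar>poly ?p t\<bar> \<le> sup_norm_on {a..b} p * ?r ^ degree ?p"
    using \<open>a < b\<close> by (intro poly_growth_interval abs_poly_le_sup_norm_on) auto
  also have "degree ?p = degree p"
    by (simp add: degree_map_poly)
  also have "sup_norm_on {a..b} p * ?r ^ degree p \<le> sup_norm_on {a..b} p * C ^ degree p"
    using \<open>a < b\<close> radius[OF \<open>t \<in> J\<close>] Bernstein_radius_ge_1[of "(2 * t - a - b) / (b - a)"]
    by (intro mult_left_mono power_mono sup_norm_on_nonneg) auto
  finally show "\<bar>poly ?p t\<bar> \<le> sup_norm_on {a..b} p * C ^ degree p" .
qed

subsection \<open>The monic integer transfinite diameter\<close>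

lemma monic_int_polys_nonempty: "monic_int_polys n \<noteq> {}"
proof -
  have "monom 1 n \<in> monic_int_polys n"
    by (simp add: monic_int_polys_def degree_monom_eq)
  then show ?thesis
    by blast
qed

lemma monic_int_polys_mult:
  assumes "p \<in> monic_int_polys m" "q \<in> monic_int_polys n"
  shows "p * q \<in> monic_int_polys (m + n)"
proof -
  have "p \<noteq> 0" "q \<noteq> 0"
    using assms by (auto simp: monic_int_polys_def)
  then show ?thesis
    using assms coeff_mult_degree_sum[of p q] by (auto simp: monic_int_polys_def degree_mult_eq)
qed

definition inf_monic_norm :: "real set \<Rightarrow> nat \<Rightarrow> real" where
  "inf_monic_norm I n = (INF p\<in>monic_int_polys n. sup_norm_on I p)"

lemma bdd_below_sup_norm_on: "compact I \<Longrightarrow> I \<noteq> {} \<Longrightarrow> bdd_below (sup_norm_on I ` A)"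
  by (rule bdd_belowI2[of _ 0]) (rule sup_norm_on_nonneg)

lemma inf_monic_norm_le:
  "compact I \<Longrightarrow> I \<noteq> {} \<Longrightarrow> p \<in> monic_int_polys n \<Longrightarrow> inf_monic_norm I n \<le> sup_norm_on I p"
  unfolding inf_monic_norm_def by (rule cINF_lower[OF bdd_below_sup_norm_on])

lemma inf_monic_norm_nonneg: "compact I \<Longrightarrow> I \<noteq> {} \<Longrightarrow> 0 \<le> inf_monic_norm I n"
  unfolding inf_monic_norm_def
  by (intro cINF_greatest monic_int_polys_nonempty sup_norm_on_nonneg)

lemma le_inf_monic_norm_multI:
  assumes "0 \<le> c" and le: "\<And>p. p \<in> monic_int_polys n \<Longrightarrow> B \<le> sup_norm_on I p * c"
  shows "B \<le> inf_monic_norm I n * c"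
proof (cases "c = 0")
  case True
  then show ?thesis
    using le monic_int_polys_nonempty by auto
next
  case False
  with \<open>0 \<le> c\<close> have "0 < c"
    by simp
  then have "B / c \<le> inf_monic_norm I n"
    unfolding inf_monic_norm_def
    using le by (intro cINF_greatest monic_int_polys_nonempty) (simp add: pos_divide_le_eq)
  then show ?thesis
    using \<open>0 < c\<close> by (simp add: pos_divide_le_eq)
qed

lemma inf_monic_norm_mult_le:
  assumes I: "compact I" "I \<noteq> {}"
  shows "inf_monic_norm I (m + n) \<le> inf_monic_norm I m * inf_monic_norm I n"
proof (rule le_inf_monic_norm_multI[OF inf_monic_norm_nonneg[OF I]])
  fix p assume p: "p \<in> monic_int_polys m"
  have "inf_monic_norm I (m + n) \<le> inf_monic_norm I n * sup_norm_on I p"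
  proof (rule le_inf_monic_norm_multI[OF sup_norm_on_nonneg[OF I]])
    fix q assume "q \<in> monic_int_polys n"
    with p have "inf_monic_norm I (m + n) \<le> sup_norm_on I (p * q)"
      by (intro inf_monic_norm_le[OF I] monic_int_polys_mult)
    also have "\<dots> \<le> sup_norm_on I q * sup_norm_on I p"
      using sup_norm_on_mult_le[OF I] by (simp add: mult.commute)
    finally show "inf_monic_norm I (m + n) \<le> \<dots>" .
  qed
  then show "inf_monic_norm I (m + n) \<le> sup_norm_on I p * inf_monic_norm I n"
    by (simp add: mult.commute)
qed

lemma submultiplicative_sequence_inf_monic_norm:
  "compact I \<Longrightarrow> I \<noteq> {} \<Longrightarrow> submultiplicative_sequence (inf_monic_norm I)"
  by unfold_locales (simp_all add: inf_monic_norm_nonneg inf_monic_norm_mult_le)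

lemma INF_sup_norm_on_powr_eq_root:
  assumes I: "compact I" "I \<noteq> {}" and "0 < n"
  shows "(INF p\<in>monic_int_polys n. sup_norm_on I p powr (1 / real n)) = root n (inf_monic_norm I n)"
proof -
  have "mono (root n)"
    using \<open>0 < n\<close> by (intro monoI) simp
  then have "root n (inf_monic_norm I n) = (INF s\<in>sup_norm_on I ` monic_int_polys n. root n s)"
    unfolding inf_monic_norm_def
  proof (rule continuous_at_Inf_mono)
    show "continuous (at_right (INF p\<in>monic_int_polys n. sup_norm_on I p)) (root n)"
      by (rule continuous_at_imp_continuous_at_within[OF isCont_real_root])
  qed (simp_all add: monic_int_polys_nonempty bdd_below_sup_norm_on[OF I])
  then show ?thesis
    using \<open>0 < n\<close> by (simp add: image_image root_powr_inverse sup_norm_on_nonneg[OF I])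
qed

theorem root_inf_monic_norm_tendsto:
  assumes I: "compact I" "I \<noteq> {}"
  shows "(\<lambda>n. root n (inf_monic_norm I n)) \<longlonglongrightarrow> monic_int_transfinite_diameter I"
proof -
  let ?v = "\<lambda>n. INF p\<in>monic_int_polys n. sup_norm_on I p powr (1 / real n)"
  obtain L where L: "(\<lambda>n. root n (inf_monic_norm I n)) \<longlonglongrightarrow> L"
    using submultiplicative_sequence.root_tendsto_INF
      [OF submultiplicative_sequence_inf_monic_norm[OF I]] by blast
  moreover have "\<forall>\<^sub>F n in sequentially. root n (inf_monic_norm I n) = ?v n"
    using eventually_gt_at_top[of 0]
    by eventually_elim (simp add: INF_sup_norm_on_powr_eq_root[OF I])
  ultimately have "?v \<longlonglongrightarrow> L"
    by (rule Lim_transform_eventually)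
  then show ?thesis
    using L by (simp add: monic_int_transfinite_diameter_def limI)
qed

lemma inf_monic_norm_growth:
  assumes "compact J" "J \<noteq> {}" "0 \<le> C"
    and growth: "\<And>p. sup_norm_on J p \<le> sup_norm_on I p * C ^ degree p"
  shows "inf_monic_norm J n \<le> inf_monic_norm I n * C ^ n"
proof (rule le_inf_monic_norm_multI)
  fix p assume p: "p \<in> monic_int_polys n"
  then have "inf_monic_norm J n \<le> sup_norm_on J p"
    using assms by (intro inf_monic_norm_le)
  also have "\<dots> \<le> sup_norm_on I p * C ^ n"
    using growth[of p] p by (simp add: monic_int_polys_def)
  finally show "inf_monic_norm J n \<le> \<dots>" .
qed (use \<open>0 \<le> C\<close> in simp)

lemma monic_int_transfinite_diameter_growth:
  assumes I: "compact I" "I \<noteq> {}" and J: "compact J" "J \<noteq> {}" and "0 \<le> C"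
    and growth: "\<And>p. sup_norm_on J p \<le> sup_norm_on I p * C ^ degree p"
  shows "monic_int_transfinite_diameter J \<le> monic_int_transfinite_diameter I * C"
proof (rule LIMSEQ_le)
  show "(\<lambda>n. root n (inf_monic_norm J n)) \<longlonglongrightarrow> monic_int_transfinite_diameter J"
    by (rule root_inf_monic_norm_tendsto[OF J])
  show "(\<lambda>n. root n (inf_monic_norm I n) * C) \<longlonglongrightarrow> monic_int_transfinite_diameter I * C"
    by (intro tendsto_mult tendsto_const root_inf_monic_norm_tendsto[OF I])
  have "root n (inf_monic_norm J n) \<le> root n (inf_monic_norm I n) * C" if "0 < n" for n
  proof -
    have "root n (inf_monic_norm J n) \<le> root n (inf_monic_norm I n * C ^ n)"
      using that inf_monic_norm_growth[OF J \<open>0 \<le> C\<close> growth] by simp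
    then show ?thesis
      using that \<open>0 \<le> C\<close> by (simp add: real_root_mult real_root_power_cancel)
  qed
  then show "\<exists>N. \<forall>n\<ge>N. root n (inf_monic_norm J n) \<le> root n (inf_monic_norm I n) * C"
    by (intro exI[of _ 1]) auto
qed

lemma t_M_growth:
  assumes "0 < x" "0 < y"
  shows "t_M x \<le> t_M y * Bernstein_radius (2 * x / y - 1)"
  unfolding t_M_def
proof (rule monic_int_transfinite_diameter_growth)
  fix p
  have "Bernstein_radius ((2 * t - 0 - y) / (y - 0)) \<le> Bernstein_radius (2 * x / y - 1)"
    if "t \<in> {0..x}" for t
  proof (rule Bernstein_radius_mono)
    have "0 \<le> 2 * t / y" "2 * t / y \<le> 2 * x / y"
      using that assms by (auto simp: divide_right_mono)
    then show "\<bar>(2 * t - 0 - y) / (y - 0)\<bar> \<le> max 1 \<bar>2 * x / y - 1\<bar>"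
      using assms by (auto simp: diff_divide_distrib)
  qed
  then show "sup_norm_on {0..x} p \<le> sup_norm_on {0..y} p * Bernstein_radius (2 * x / y - 1) ^ degree p"
    using assms by (intro sup_norm_on_growth) auto
qed (use assms in \<open>auto simp: less_imp_le Bernstein_radius_pos\<close>)

theorem theorem2p3:
  shows "continuous_on {0<..} t_M"
proof (intro continuous_at_imp_continuous_on ballI)
  fix a :: real
  assume "a \<in> {0<..}"
  then have a: "0 < a"
    by simp
  let ?lower = "\<lambda>x. t_M a / Bernstein_radius (2 * a / x - 1)"
  let ?upper = "\<lambda>x. t_M a * Bernstein_radius (2 * x / a - 1)"
  have pos: "\<forall>\<^sub>F x in at a. 0 < x"
    using order_tendstoD(1)[OF tendsto_ident_at a] .
  have lower: "\<forall>\<^sub>F x in at a. ?lower x \<le> t_M x"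
    using pos
    by eventually_elim (simp add: pos_divide_le_eq Bernstein_radius_pos t_M_growth[OF a])
  have upper: "\<forall>\<^sub>F x in at a. t_M x \<le> ?upper x"
    using pos by eventually_elim (rule t_M_growth[OF _ a])
  have "isCont ?lower a" "isCont ?upper a"
    using a Bernstein_radius_eq_1[of 1] by (intro continuous_intros; simp)+
  then have "(?lower \<longlongrightarrow> t_M a) (at a)" "(?upper \<longlongrightarrow> t_M a) (at a)"
    using a Bernstein_radius_eq_1[of 1] by (auto simp: isCont_def)
  then show "isCont t_M a"
    unfolding isCont_def by (rule tendsto_sandwich[OF lower upper])
qed

end
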